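(* For every $n\ge 4$, there exists an $n$-vertex physical connectivity graph $G_{ph}$ such that $k_\epsilon^*(G_{ph})=\infty$ for all $\epsilon\in(0,R/2)$.
   Context: Social Hegselmann-Krause (HK) dynamics: there are $n$ agents, with $[n]=\{1,\dots,n\}$, and a fixed confidence bound $R>0$. The physical connectivity graph $G_{ph}=([n],E_{ph})$ is an undirected, time-invariant, connected graph containing all self-loops. The state at time $k=0,1,2,\dots$ is $x[k]\in\mathbb{R}^n$. The influence graph $\tilde G[k]$ has vertex set $[n]$ and has the edge $(i,j)$ iff $(i,j)\in E_{ph}$ and $|x_i[k]-x_j[k]|\le R$. The update rule is $x_i[k+1]=\frac{1}{|\mathcal N_i[k]|}\sum_{j\in\mathcal N_i[k]}x_j[k]$, where $\mathcal N_i[k]$ is the set of neighbors of $i$ in $\tilde G[k]$ (including $i$ itself). For every initial state $x[0]=x_0$ the limit (steady state) $x_\infty(x_0):=\lim_{k\to\infty}x[k]$ exists. For $\epsilon>0$, the $\epsilon$-convergence time is $k_\epsilon(G_{ph},x_0):=\inf\{N\in\mathbb{N}:\|x[k]-x_\infty(x_0)\|<\epsilon\text{ for all }k\ge N\}$ (Euclidean norm), and the maximum $\epsilon$-convergence time is $k_\epsilon^*(G_{ph}):=\sup_{x_0\in\mathbb{R}^n}k_\epsilon(G_{ph},x_0)$. *)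

theory Defs
  imports "HOL-Analysis.Analysis" "HOL-Library.Extended_Nat"
begin

text \<open>
  The agents are the elements of a finite type \<open>'n\<close>, so \<open>n\<close> is \<open>CARD('n)\<close>. An undirected graph
  on the agents is given by a symmetric set of ordered pairs, a self-loop at \<open>i\<close> being \<open>(i, i)\<close>.
\<close>

definition physical_graph :: "('n \<times> 'n) set \<Rightarrow> bool" where
  "physical_graph E \<longleftrightarrow> sym E \<and> refl E \<and> (\<forall>i j. (i, j) \<in> E\<^sup>*)"

definition influence_graph :: "real \<Rightarrow> ('n \<times> 'n) set \<Rightarrow> real ^ 'n \<Rightarrow> ('n \<times> 'n) set" where
  "influence_graph R E x = {(i, j). (i, j) \<in> E \<and> \<bar>x $ i - x $ j\<bar> \<le> R}"

definition neighbors :: "real \<Rightarrow> ('n \<times> 'n) set \<Rightarrow> real ^ 'n \<Rightarrow> 'n \<Rightarrow> 'n set" where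
  "neighbors R E x i = {j. (i, j) \<in> influence_graph R E x}"

definition hk_step :: "real \<Rightarrow> ('n::finite \<times> 'n) set \<Rightarrow> real ^ 'n \<Rightarrow> real ^ 'n" where
  "hk_step R E x =
     (\<chi> i. (1 / real (card (neighbors R E x i))) * (\<Sum>j\<in>neighbors R E x i. x $ j))"

primrec hk_state :: "real \<Rightarrow> ('n::finite \<times> 'n) set \<Rightarrow> real ^ 'n \<Rightarrow> nat \<Rightarrow> real ^ 'n" where
  "hk_state R E x0 0 = x0"
| "hk_state R E x0 (Suc k) = hk_step R E (hk_state R E x0 k)"

definition steady_state :: "real \<Rightarrow> ('n::finite \<times> 'n) set \<Rightarrow> real ^ 'n \<Rightarrow> real ^ 'n" where
  "steady_state R E x0 = lim (hk_state R E x0)"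

text \<open>
  Convergence times are extended naturals, in which the infimum of the empty set and the
  supremum of an unbounded set are both \<open>\<infinity>\<close>.
\<close>

definition conv_time :: "real \<Rightarrow> ('n::finite \<times> 'n) set \<Rightarrow> real \<Rightarrow> real ^ 'n \<Rightarrow> enat" where
  "conv_time R E \<epsilon> x0 =
     Inf {enat N | N. \<forall>k\<ge>N. norm (hk_state R E x0 k - steady_state R E x0) < \<epsilon>}"

definition max_conv_time :: "real \<Rightarrow> ('n::finite \<times> 'n) set \<Rightarrow> real \<Rightarrow> enat" where
  "max_conv_time R E \<epsilon> = (SUP x0. conv_time R E \<epsilon> x0)"

end

theory Submission imports Defs begin

text \<open>
  Arrange four agents \<open>p, q, r, s\<close> in a path and start them at \<open>(R, 0, -R, R - h)\<close> with
  \<open>h = R / 2^K\<close>. As long as \<open>r\<close> and \<open>s\<close> do not see each other, \<open>s\<close> does not move, and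
  \<open>(1, 0, -1)\<close> is an eigenvector of the averaging on \<open>p, q, r\<close> for the eigenvalue \<open>1/2\<close>; so at
  time \<open>k\<close> agent \<open>r\<close> is at \<open>-R / 2^k\<close>. The gap between \<open>r\<close> and \<open>s\<close> is \<open>R - h + R / 2^k\<close>,
  which exceeds \<open>R\<close> for every \<open>k < K\<close> and equals \<open>R\<close> at time \<open>K\<close>
  (lemma \<open>states_before_link\<close>). At that moment the four agents lie in an interval of length
  \<open>R\<close>. They never leave it again, so all three edges of the path are active from then on and the
  four agents reach a consensus (lemmas \<open>states_after_link\<close> and \<open>path_consensus\<close>).

  Hence \<open>r\<close> and \<open>s\<close> have the same limit although they are more than \<open>R\<close> apart at time \<open>K - 1\<close>.
  One of them is then at distance at least \<open>R / 2\<close> from that limit, so the convergence time for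
  any \<open>\<epsilon> < R / 2\<close> is at least \<open>K\<close>, and \<open>K\<close> is arbitrary.

  Any further agents are placed together at \<open>3 * R\<close>, out of sight of the path. They stay there for
  ever, so they may be joined to each other and to the path without any effect on the dynamics;
  this is what makes the graph connected for every number of agents.
\<close>

section \<open>Averaging along a path of four agents\<close>

text \<open>
  The averaging matrix commutes with the reversal of the path. On the symmetric part the
  difference between the outer and the inner pair is an eigenvector for \<open>1/6\<close>, and the
  degree-weighted mean is conserved. On the antisymmetric part the outer difference \<open>P\<close> and the
  inner difference \<open>Q\<close> evolve by \<open>P' = (P + Q) / 2\<close> and \<open>Q' = P / 3\<close>, which contracts
  \<open>max \<bar>P\<bar> (2 * \<bar>Q\<bar>)\<close> by at least the factor \<open>3/4\<close>.
\<close>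

lemma path_consensus:
  fixes a b c d :: "nat \<Rightarrow> real"
  assumes a: "\<And>m. a (Suc m) = (a m + b m) / 2"
    and b: "\<And>m. b (Suc m) = (a m + b m + c m) / 3"
    and c: "\<And>m. c (Suc m) = (b m + c m + d m) / 3"
    and d: "\<And>m. d (Suc m) = (c m + d m) / 2"
  shows "\<exists>l. a \<longlonglongrightarrow> l \<and> b \<longlonglongrightarrow> l \<and> c \<longlonglongrightarrow> l \<and> d \<longlonglongrightarrow> l"
proof -
  define e where "e = (\<lambda>m. (a m + d m) - (b m + c m))"
  define P where "P = (\<lambda>m. a m - d m)"
  define Q where "Q = (\<lambda>m. b m - c m)"
  define W where "W = 2 * (a 0 + d 0) + 3 * (b 0 + c 0)"
  define C where "C = \<bar>P 0\<bar> + 2 * \<bar>Q 0\<bar>"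
  have mean: "2 * (a m + d m) + 3 * (b m + c m) = W" for m
  proof (induction m)
    case (Suc m)
    then show ?case by (simp add: a b c d field_simps)
  qed (simp add: W_def)
  have "e m = e 0 * (1/6) ^ m" for m
  proof (induction m)
    case (Suc m)
    have "e (Suc m) = e m / 6" by (simp add: e_def a b c d field_simps)
    then show ?case using Suc by simp
  qed simp
  then have "e = (\<lambda>m. e 0 * (1/6) ^ m)" by blast
  moreover have "(\<lambda>m. e 0 * (1/6) ^ m) \<longlonglongrightarrow> e 0 * 0"
    by (intro tendsto_intros LIMSEQ_realpow_zero) auto
  ultimately have e0: "e \<longlonglongrightarrow> 0" by simp
  have bound: "\<bar>P m\<bar> \<le> C * (3/4) ^ m \<and> 2 * \<bar>Q m\<bar> \<le> C * (3/4) ^ m" for m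
  proof (induction m)
    case (Suc m)
    have "P (Suc m) = (P m + Q m) / 2" "Q (Suc m) = P m / 3"
      by (simp_all add: P_def Q_def a b c d field_simps)
    then show ?case using Suc by (auto simp: abs_if split: if_splits)
  qed (simp add: C_def)
  have C0: "(\<lambda>m. C * (3/4) ^ m) \<longlonglongrightarrow> 0"
    using tendsto_mult[OF tendsto_const[of C] LIMSEQ_realpow_zero[of "3/4 :: real"]] by simp
  have P0: "P \<longlonglongrightarrow> 0"
    by (rule Lim_null_comparison[OF _ C0]) (use bound in auto)
  have Q0: "Q \<longlonglongrightarrow> 0"
    by (rule Lim_null_comparison[OF _ C0])
      (intro always_eventually allI, use bound abs_ge_zero in \<open>smt (verit) real_norm_def\<close>)
  \<comment> \<open>The mean \<open>W\<close> and the vanishing quantities \<open>e, P, Q\<close> are coordinates for the state.\<close>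
  have coords: "a = (\<lambda>m. W / 10 + 3 / 10 * e m + P m / 2)"
    "b = (\<lambda>m. W / 10 - e m / 5 + Q m / 2)"
    "c = (\<lambda>m. W / 10 - e m / 5 - Q m / 2)"
    "d = (\<lambda>m. W / 10 + 3 / 10 * e m - P m / 2)"
    by (rule ext; use mean in \<open>simp add: e_def P_def Q_def field_simps; smt (verit)\<close>)+
  have "a \<longlonglongrightarrow> W / 10 + 3 / 10 * 0 + 0 / 2"
    by (subst coords(1)) (intro tendsto_intros e0 P0; simp)
  moreover have "b \<longlonglongrightarrow> W / 10 - 0 / 5 + 0 / 2"
    by (subst coords(2)) (intro tendsto_intros e0 Q0; simp)
  moreover have "c \<longlonglongrightarrow> W / 10 - 0 / 5 - 0 / 2"
    by (subst coords(3)) (intro tendsto_intros e0 Q0; simp)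
  moreover have "d \<longlonglongrightarrow> W / 10 + 3 / 10 * 0 - 0 / 2"
    by (subst coords(4)) (intro tendsto_intros e0 P0; simp)
  ultimately show ?thesis by auto
qed

section \<open>A path whose remaining agents are out of sight\<close>

text \<open>
  Leaving out just these pairs keeps \<open>p - q - r - s\<close> as a path and makes every other agent
  adjacent to all agents.
\<close>

definition path_and_clique :: "'n \<Rightarrow> 'n \<Rightarrow> 'n \<Rightarrow> 'n \<Rightarrow> ('n \<times> 'n) set" where
  "path_and_clique p q r s = - {(p, r), (r, p), (p, s), (s, p), (q, s), (s, q)}"

lemma hk_step_mean:
  "hk_step R E x $ i = (\<Sum>j\<in>neighbors R E x i. x $ j) / real (card (neighbors R E x i))"
  by (simp add: hk_step_def)

locale four_agents =
  fixes p q r s :: "'n::finite"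
  assumes distinct: "distinct [p, q, r, s]"
begin

abbreviation "E \<equiv> path_and_clique p q r s"

lemma neqs [simp]: "p \<noteq> q" "p \<noteq> r" "p \<noteq> s" "q \<noteq> r" "q \<noteq> s" "r \<noteq> s"
  "q \<noteq> p" "r \<noteq> p" "s \<noteq> p" "r \<noteq> q" "s \<noteq> q" "s \<noteq> r"
  using distinct by auto

lemma physical_graph_path_and_clique: "physical_graph E"
proof -
  have sym: "sym E" by (auto simp: sym_def path_and_clique_def)
  moreover have "refl E" by (auto simp: refl_on_def path_and_clique_def)
  moreover have "(i, j) \<in> E\<^sup>*" for i j
  proof -
    \<comment> \<open>Every agent but \<open>s\<close> is adjacent to \<open>q\<close>, and \<open>s\<close> reaches \<open>q\<close> through \<open>r\<close>.\<close>
    have to_q: "(i, q) \<in> E\<^sup>*" for i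
    proof (cases "i = s")
      case True
      have "(s, r) \<in> E" "(r, q) \<in> E" by (auto simp: path_and_clique_def)
      then show ?thesis using True by (meson r_into_rtrancl rtrancl.rtrancl_into_rtrancl)
    next
      case False
      then have "(i, q) \<in> E" by (auto simp: path_and_clique_def)
      then show ?thesis by blast
    qed
    then have "(q, j) \<in> E\<^sup>*" using sym_rtrancl[OF sym] by (meson symD)
    with to_q show ?thesis by (meson rtrancl_trans)
  qed
  ultimately show ?thesis by (simp add: physical_graph_def)
qed

text \<open>
  The position \<open>3 * R\<close> is at distance at least \<open>2 * R\<close> from \<open>[- R, R]\<close>, so no edge between the
  path and the other agents is active, while those others all average equal values.
\<close>

definition apart :: "real \<Rightarrow> real ^ 'n \<Rightarrow> bool" where
  "apart R x \<longleftrightarrow> (\<forall>i\<in>{p, q, r, s}. \<bar>x $ i\<bar> \<le> R) \<and> (\<forall>i. i \<notin> {p, q, r, s} \<longrightarrow> x $ i = 3 * R)"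

context
  fixes R :: real and x :: "real ^ 'n"
  assumes R: "R > 0" and apart: "apart R x"
begin

lemma far: "i \<in> {p, q, r, s} \<Longrightarrow> j \<notin> {p, q, r, s} \<Longrightarrow> \<bar>x $ i - x $ j\<bar> > R \<and> \<bar>x $ j - x $ i\<bar> > R"
proof -
  assume "i \<in> {p, q, r, s}" "j \<notin> {p, q, r, s}"
  then have "\<bar>x $ i\<bar> \<le> R" "x $ j = 3 * R" using apart by (auto simp: apart_def)
  then show ?thesis using R by (auto simp: abs_if split: if_splits)
qed

lemma neighbors_on_path:
  assumes "i \<in> {p, q, r, s}"
  shows "neighbors R E x i = {j\<in>{p, q, r, s}. (i, j) \<in> E \<and> \<bar>x $ i - x $ j\<bar> \<le> R}"
  using far[OF assms] by (force simp: neighbors_def influence_graph_def)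

lemma step_off_path:
  assumes "i \<notin> {p, q, r, s}"
  shows "hk_step R E x $ i = 3 * R"
proof -
  have "neighbors R E x i \<subseteq> - {p, q, r, s}"
    using far[OF _ assms] by (force simp: neighbors_def influence_graph_def)
  then have "(\<Sum>j\<in>neighbors R E x i. x $ j) = (\<Sum>j\<in>neighbors R E x i. 3 * R)"
    using apart by (intro sum.cong) (auto simp: apart_def)
  moreover have "i \<in> neighbors R E x i"
    using assms R by (auto simp: neighbors_def influence_graph_def path_and_clique_def)
  then have "card (neighbors R E x i) \<noteq> 0" by auto
  ultimately show ?thesis by (simp add: hk_step_mean)
qed

lemma step_p:
  assumes "\<bar>x $ p - x $ q\<bar> \<le> R"
  shows "hk_step R E x $ p = (x $ p + x $ q) / 2"
proof -
  have "neighbors R E x p = {p, q}"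
    using assms R by (subst neighbors_on_path) (auto simp: path_and_clique_def)
  then show ?thesis by (simp add: hk_step_mean)
qed

lemma step_q:
  assumes "\<bar>x $ p - x $ q\<bar> \<le> R" "\<bar>x $ q - x $ r\<bar> \<le> R"
  shows "hk_step R E x $ q = (x $ p + x $ q + x $ r) / 3"
proof -
  have "neighbors R E x q = {p, q, r}"
    using assms R by (subst neighbors_on_path) (auto simp: path_and_clique_def abs_minus_commute)
  then show ?thesis by (simp add: hk_step_mean)
qed

lemma step_r_unlinked:
  assumes "\<bar>x $ q - x $ r\<bar> \<le> R" "\<bar>x $ r - x $ s\<bar> > R"
  shows "hk_step R E x $ r = (x $ q + x $ r) / 2"
proof -
  have "neighbors R E x r = {q, r}"
    using assms R by (subst neighbors_on_path) (auto simp: path_and_clique_def abs_minus_commute)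
  then show ?thesis by (simp add: hk_step_mean)
qed

lemma step_r_linked:
  assumes "\<bar>x $ q - x $ r\<bar> \<le> R" "\<bar>x $ r - x $ s\<bar> \<le> R"
  shows "hk_step R E x $ r = (x $ q + x $ r + x $ s) / 3"
proof -
  have "neighbors R E x r = {q, r, s}"
    using assms R by (subst neighbors_on_path) (auto simp: path_and_clique_def abs_minus_commute)
  then show ?thesis by (simp add: hk_step_mean)
qed

lemma step_s_unlinked:
  assumes "\<bar>x $ r - x $ s\<bar> > R"
  shows "hk_step R E x $ s = x $ s"
proof -
  have "neighbors R E x s = {s}"
    using assms R by (subst neighbors_on_path) (auto simp: path_and_clique_def abs_minus_commute)
  then show ?thesis by (simp add: hk_step_mean)
qed

lemma step_s_linked:
  assumes "\<bar>x $ r - x $ s\<bar> \<le> R"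
  shows "hk_step R E x $ s = (x $ r + x $ s) / 2"
proof -
  have "neighbors R E x s = {r, s}"
    using assms R by (subst neighbors_on_path) (auto simp: path_and_clique_def abs_minus_commute)
  then show ?thesis by (simp add: hk_step_mean)
qed

end

section \<open>A link that forms late\<close>

definition start :: "real \<Rightarrow> nat \<Rightarrow> real ^ 'n" where
  "start R K = (\<chi> i. if i = p then R else if i = q then 0 else if i = r then - R
     else if i = s then R - R / 2 ^ K else 3 * R)"

text \<open>
  The bound \<open>k < K\<close> on the time before linking enters through \<open>R / 2^K < R / 2^k\<close>: agent \<open>r\<close>
  is still below the point \<open>- R / 2^K\<close>, at which it would see \<open>s\<close>.
\<close>

lemma states_before_link:
  assumes R: "R > 0" and "k \<le> K"
  defines "x \<equiv> hk_state R E (start R K) k"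
  shows "x $ p = R / 2 ^ k \<and> x $ q = 0 \<and> x $ r = - R / 2 ^ k \<and> x $ s = R - R / 2 ^ K \<and>
    (\<forall>i. i \<notin> {p, q, r, s} \<longrightarrow> x $ i = 3 * R)"
  using \<open>k \<le> K\<close> unfolding x_def
proof (induction k)
  case 0
  show ?case by (simp add: start_def)
next
  case (Suc k)
  define y where "y = hk_state R E (start R K) k"
  have y: "y $ p = R / 2 ^ k" "y $ q = 0" "y $ r = - R / 2 ^ k" "y $ s = R - R / 2 ^ K"
      "\<And>i. i \<notin> {p, q, r, s} \<Longrightarrow> y $ i = 3 * R"
    using Suc by (auto simp: y_def)
  have pow: "0 < R / 2 ^ k" "R / 2 ^ k \<le> R" "0 < R / 2 ^ K" "R / 2 ^ K \<le> R"
    using R by (simp_all add: divide_le_eq)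
  have "R / 2 ^ K < R / 2 ^ k"
    using R Suc.prems by (intro divide_strict_left_mono power_strict_increasing) auto
  then have unlinked: "\<bar>y $ r - y $ s\<bar> > R" using R pow by (simp add: y)
  have linked: "\<bar>y $ p - y $ q\<bar> \<le> R" "\<bar>y $ q - y $ r\<bar> \<le> R"
    using pow by (auto simp: y)
  have "apart R y" using pow by (auto simp: apart_def y)
  note step = step_p[OF R this linked(1)] step_q[OF R this linked]
    step_r_unlinked[OF R this linked(2) unlinked] step_s_unlinked[OF R this unlinked]
    step_off_path[OF R this]
  have "hk_state R E (start R K) (Suc k) = hk_step R E y" by (simp add: y_def)
  then show ?case using step by (simp add: y)
qed

text \<open>
  From the moment of linking on, the path agents live in \<open>[- h, R - h]\<close> where \<open>h = R / 2^K\<close>.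
  The case \<open>K = 0\<close> is excluded because \<open>p\<close>, which is then at \<open>h\<close>, must lie in that interval.
\<close>

lemma states_after_link:
  assumes R: "R > 0" and "K > 0"
  defines "h \<equiv> R / 2 ^ K"
  defines "x \<equiv> \<lambda>m. hk_state R E (start R K) (m + K)"
  shows "(\<forall>i\<in>{p, q, r, s}. - h \<le> x m $ i \<and> x m $ i \<le> R - h) \<and> apart R (x m)"
proof -
  have h: "0 < h" "2 * h \<le> R"
  proof -
    have "(2 :: real) \<le> 2 ^ K" using \<open>K > 0\<close> self_le_power[of "2::real" K] by simp
    then show "0 < h" "2 * h \<le> R" using R by (simp_all add: h_def field_simps)
  qed
  have box: "(\<forall>i\<in>{p, q, r, s}. - h \<le> y $ i \<and> y $ i \<le> R - h) \<Longrightarrow>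
      (\<And>i. i \<notin> {p, q, r, s} \<Longrightarrow> y $ i = 3 * R) \<Longrightarrow> apart R y" for y
    using h R by (auto simp: apart_def)
  show ?thesis
  proof (induction m)
    case 0
    show ?case
      using states_before_link[OF R order_refl, of K] h
      by (intro conjI box) (auto simp: x_def h_def)
  next
    case (Suc m)
    then have ap: "apart R (x m)" and
      b: "- h \<le> x m $ p" "x m $ p \<le> R - h" "- h \<le> x m $ q" "x m $ q \<le> R - h"
         "- h \<le> x m $ r" "x m $ r \<le> R - h" "- h \<le> x m $ s" "x m $ s \<le> R - h" by auto
    have l: "\<bar>x m $ p - x m $ q\<bar> \<le> R" "\<bar>x m $ q - x m $ r\<bar> \<le> R" "\<bar>x m $ r - x m $ s\<bar> \<le> R"
      using b by auto
    have "x (Suc m) = hk_step R E (x m)" by (simp add: x_def)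
    then show ?case
      using step_p[OF R ap l(1)] step_q[OF R ap l(1,2)] step_r_linked[OF R ap l(2,3)]
        step_s_linked[OF R ap l(3)] step_off_path[OF R ap] b
      by (intro conjI box) auto
  qed
qed

text \<open>
  After the link has formed, the coordinates on the path obey the recurrences of
  \<open>path_consensus\<close> and the others are constant, so the whole state converges; without this,
  \<open>steady_state\<close>, defined by \<open>lim\<close>, would be an arbitrary value.
\<close>

lemma steady_state_consensus:
  assumes R: "R > 0" and "K > 0"
  shows "steady_state R E (start R K) $ r = steady_state R E (start R K) $ s"
proof -
  define x where "x = (\<lambda>m. hk_state R E (start R K) (m + K))"
  have ap: "apart R (x m)" for m
    using states_after_link[OF assms] by (simp add: x_def)
  have l: "\<bar>x m $ p - x m $ q\<bar> \<le> R" "\<bar>x m $ q - x m $ r\<bar> \<le> R" "\<bar>x m $ r - x m $ s\<bar> \<le> R" for m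
    using states_after_link[OF assms, of m] by (auto simp: x_def)
  have step: "x (Suc m) = hk_step R E (x m)" for m by (simp add: x_def)
  obtain c where c: "(\<lambda>m. x m $ p) \<longlonglongrightarrow> c" "(\<lambda>m. x m $ q) \<longlonglongrightarrow> c"
      "(\<lambda>m. x m $ r) \<longlonglongrightarrow> c" "(\<lambda>m. x m $ s) \<longlonglongrightarrow> c"
    using path_consensus[of "\<lambda>m. x m $ p" "\<lambda>m. x m $ q" "\<lambda>m. x m $ r" "\<lambda>m. x m $ s"]
      step_p[OF R ap l(1)] step_q[OF R ap l(1,2)] step_r_linked[OF R ap l(2,3)]
      step_s_linked[OF R ap l(3)]
    unfolding step by blast
  define L where "L = (\<chi> i. if i \<in> {p, q, r, s} then c else 3 * R)"
  have "x \<longlonglongrightarrow> L"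
  proof (rule vec_tendstoI)
    fix i
    show "(\<lambda>m. x m $ i) \<longlonglongrightarrow> L $ i"
      using c ap by (cases "i \<in> {p, q, r, s}") (auto simp: L_def apart_def)
  qed
  then have "hk_state R E (start R K) \<longlonglongrightarrow> L"
    unfolding x_def by (rule LIMSEQ_offset)
  then have "steady_state R E (start R K) = L"
    unfolding steady_state_def by (rule limI)
  then show ?thesis by (simp add: L_def)
qed

text \<open>
  One step before \<open>r\<close> and \<open>s\<close> link they are still more than \<open>R\<close> apart, and no common limit can be closer
  than half of that distance to both.
\<close>

lemma far_from_steady_state:
  assumes R: "R > 0"
  shows "norm (hk_state R E (start R (Suc N)) N - steady_state R E (start R (Suc N))) \<ge> R / 2"
    (is "norm (?x - ?L) \<ge> _")
proof -
  have "?x $ r = - R / 2 ^ N" "?x $ s = R - R / 2 ^ Suc N"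
    using states_before_link[OF R, of N "Suc N"] by auto
  moreover have "R / 2 ^ Suc N \<le> R / 2 ^ N" using R by (simp add: field_simps)
  ultimately have "?x $ s - ?x $ r \<ge> R" by linarith
  moreover have "?L $ r = ?L $ s" using steady_state_consensus[OF R] by simp
  ultimately have "R / 2 \<le> \<bar>(?x - ?L) $ r\<bar> \<or> R / 2 \<le> \<bar>(?x - ?L) $ s\<bar>"
    by (auto simp: abs_if)
  then show ?thesis
    using component_le_norm_cart[of "?x - ?L" r] component_le_norm_cart[of "?x - ?L" s] by linarith
qed

lemma max_conv_time_infinite:
  assumes R: "R > 0" and "\<epsilon> < R / 2"
  shows "max_conv_time R E \<epsilon> = \<infinity>"
proof -
  have "enat N \<le> max_conv_time R E \<epsilon>" for N
  proof -
    have "enat N \<le> conv_time R E \<epsilon> (start R (Suc N))"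
      unfolding conv_time_def
    proof (rule Inf_greatest, clarify)
      fix M
      assume M: "\<forall>k\<ge>M. norm (hk_state R E (start R (Suc N)) k
        - steady_state R E (start R (Suc N))) < \<epsilon>"
      have "\<not> M \<le> N"
        using M far_from_steady_state[OF R, of N] \<open>\<epsilon> < R / 2\<close> by fastforce
      then show "enat N \<le> enat M" by simp
    qed
    also have "\<dots> \<le> max_conv_time R E \<epsilon>"
      unfolding max_conv_time_def by (rule SUP_upper) simp
    finally show ?thesis .
  qed
  then show ?thesis
    by (metis Suc_n_not_le_n enat_ord_simps(1) not_infinity_eq)
qed

end

theorem lemma3:
  fixes R :: real
  assumes "R > 0"
    and "CARD('n::finite) \<ge> 4"
  shows "\<exists>E :: ('n \<times> 'n) set. physical_graph E \<and>
           (\<forall>\<epsilon>. 0 < \<epsilon> \<and> \<epsilon> < R / 2 \<longrightarrow> max_conv_time R E \<epsilon> = \<infinity>)"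
proof -
  obtain A :: "'n set" where "card A = 4"
    using obtain_subset_with_card_n[OF assms(2)] by blast
  then obtain p q r s where "A = {p, q, r, s}" "distinct [p, q, r, s]"
    by (auto simp: card_Suc_eq numeral_eq_Suc)
  then interpret four_agents p q r s by unfold_locales
  show ?thesis
    using physical_graph_path_and_clique max_conv_time_infinite[OF assms(1)] by blast
qed

end
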